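(* Let $(L,[-,-]_1,[-,-]_2)$ be a compatible Leibniz algebra over a field $\mathbb{K}$ such that the associated ternary Leibniz algebras $(L,\{-,-,-\}_1)$ and $(L,\{-,-,-\}_2)$, where $\{x,y,z\}_i=[x,[y,z]_i]_i$, are compatible. Let $D:L\to L$ be a central derivation of the compatible Leibniz algebra $(L,[-,-]_1,[-,-]_2)$, i.e. a linear map such that for all $x,y\in L$ and $i=1,2$, $$D([x,y]_i)=[D(x),y]_i=[x,D(y)]_i=0.$$ Then $D$ is also a central derivation of the compatible ternary Leibniz algebra $(L,\{-,-,-\}_1,\{-,-,-\}_2)$.
   Context: A Leibniz algebra is a vector space $L$ with a bilinear bracket satisfying $[[x,y],z]=[x,[y,z]]+[[x,z],y]$. A compatible Leibniz algebra is a triple $(L,[-,-]_1,[-,-]_2)$ with both brackets Leibniz and $\lambda_1[-,-]_1+\lambda_2[-,-]_2$ a Leibniz bracket for all $\lambda_1,\lambda_2\in\mathbb{K}$; equivalently $[[x,y]_1,z]_2+[[x,y]_2,z]_1=[x,[y,z]_1]_2+[x,[y,z]_2]_1+[[x,z]_1,y]_2+[[x,z]_2,y]_1$. A ternary Leibniz algebra is a vector space with a trilinear bracket $\{-,-,-\}$ satisfying $\{\{x,y,z\},t,u\}=\{x,y,\{z,t,u\}\}+\{x,\{y,t,u\},z\}+\{\{x,t,u\},y,z\}$. For any Leibniz algebra $(L,[-,-])$, $T(L)=(L,\{x,y,z\}:=[x,[y,z]])$ is a ternary Leibniz algebra, called the associated one. Two ternary Leibniz brackets on $L$ are compatible if \begin{align*}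 \{\{x,y,z\}_1,t,u\}_2+\{\{x,y,z\}_2,t,u\}_1&=\{x,y,\{z,t,u\}_1\}_2+\{x,y,\{z,t,u\}_2\}_1+\{x,\{y,t,u\}_1,z\}_2\\ &\quad+\{x,\{y,t,u\}_2,z\}_1+\{\{x,t,u\}_1,y,z\}_2+\{\{x,t,u\}_2,y,z\}_1 \end{align*} for all $x,y,z,t,u$; then $(L,\{\cdot\}_1,\{\cdot\}_2)$ is a compatible ternary Leibniz algebra. A central derivation of a ternary Leibniz algebra is a linear map $D$ with $D(\{x,y,z\})=\{D(x),y,z\}=\{x,D(y),z\}=\{x,y,D(z)\}=0$ for all $x,y,z$; a central derivation of a compatible ternary Leibniz algebra is a central derivation for both brackets. *)

theory Defs
  imports Complex_Main
begin

text \<open>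
  The vector space \<open>L\<close> over the field \<open>K\<close> is the library locale \<^locale>\<open>vector_space\<close>:
  \<open>K\<close> is a type of class \<open>field\<close>, \<open>L\<close> a type of class \<open>ab_group_add\<close>, and the scalar
  multiplication is the parameter \<open>scale\<close>. No restriction is made on the characteristic
  of \<open>K\<close> or on the dimension of \<open>L\<close>. Brackets are curried functions, and all Leibniz
  algebras are right Leibniz algebras: right multiplications are derivations.
\<close>

locale leibniz_algebra = vector_space scale
  for scale :: "'k::field \<Rightarrow> 'l::ab_group_add \<Rightarrow> 'l" +
  fixes br :: "'l \<Rightarrow> 'l \<Rightarrow> 'l"
  assumes linear_left: "Vector_Spaces.linear scale scale (\<lambda>x. br x y)"
    and linear_right: "Vector_Spaces.linear scale scale (\<lambda>y. br x y)"
    and leibniz: "br (br x y) z = br x (br y z) + br (br x z) y"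

locale compatible_leibniz_algebra =
  L1: leibniz_algebra scale br1 + L2: leibniz_algebra scale br2
  for scale :: "'k::field \<Rightarrow> 'l::ab_group_add \<Rightarrow> 'l"
    and br1 br2 :: "'l \<Rightarrow> 'l \<Rightarrow> 'l" +
  assumes pencil: "leibniz_algebra scale (\<lambda>x y. scale a (br1 x y) + scale b (br2 x y))"

locale ternary_leibniz_algebra = vector_space scale
  for scale :: "'k::field \<Rightarrow> 'l::ab_group_add \<Rightarrow> 'l" +
  fixes tbr :: "'l \<Rightarrow> 'l \<Rightarrow> 'l \<Rightarrow> 'l"
  assumes linear_1: "Vector_Spaces.linear scale scale (\<lambda>x. tbr x y z)"
    and linear_2: "Vector_Spaces.linear scale scale (\<lambda>y. tbr x y z)"
    and linear_3: "Vector_Spaces.linear scale scale (\<lambda>z. tbr x y z)"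
    and ternary_leibniz:
      "tbr (tbr x y z) t u = tbr x y (tbr z t u) + tbr x (tbr y t u) z + tbr (tbr x t u) y z"

definition assoc_ternary :: "('l \<Rightarrow> 'l \<Rightarrow> 'l) \<Rightarrow> 'l \<Rightarrow> 'l \<Rightarrow> 'l \<Rightarrow> 'l"
  where "assoc_ternary br x y z = br x (br y z)"

definition ternary_compatible ::
    "('l::ab_group_add \<Rightarrow> 'l \<Rightarrow> 'l \<Rightarrow> 'l) \<Rightarrow> ('l \<Rightarrow> 'l \<Rightarrow> 'l \<Rightarrow> 'l) \<Rightarrow> bool"
  where "ternary_compatible t1 t2 \<longleftrightarrow>
    (\<forall>x y z t u.
      t2 (t1 x y z) t u + t1 (t2 x y z) t u =
        t2 x y (t1 z t u) + t1 x y (t2 z t u)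
      + t2 x (t1 y t u) z + t1 x (t2 y t u) z
      + t2 (t1 x t u) y z + t1 (t2 x t u) y z)"

locale compatible_ternary_leibniz_algebra =
  T1: ternary_leibniz_algebra scale t1 + T2: ternary_leibniz_algebra scale t2
  for scale :: "'k::field \<Rightarrow> 'l::ab_group_add \<Rightarrow> 'l"
    and t1 t2 :: "'l \<Rightarrow> 'l \<Rightarrow> 'l \<Rightarrow> 'l" +
  assumes compatible: "ternary_compatible t1 t2"

text \<open>Each predicate below includes that the underlying structure is an algebra of the
  respective kind, as well as the linearity of \<open>D\<close>.\<close>

definition leibniz_central_derivation ::
    "('k::field \<Rightarrow> 'l::ab_group_add \<Rightarrow> 'l) \<Rightarrow> ('l \<Rightarrow> 'l \<Rightarrow> 'l) \<Rightarrow> ('l \<Rightarrow> 'l) \<Rightarrow> bool"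
  where "leibniz_central_derivation scale br D \<longleftrightarrow>
    leibniz_algebra scale br \<and> Vector_Spaces.linear scale scale D \<and>
    (\<forall>x y. D (br x y) = 0 \<and> br (D x) y = 0 \<and> br x (D y) = 0)"

definition compatible_leibniz_central_derivation ::
    "('k::field \<Rightarrow> 'l::ab_group_add \<Rightarrow> 'l) \<Rightarrow> ('l \<Rightarrow> 'l \<Rightarrow> 'l) \<Rightarrow> ('l \<Rightarrow> 'l \<Rightarrow> 'l)
      \<Rightarrow> ('l \<Rightarrow> 'l) \<Rightarrow> bool"
  where "compatible_leibniz_central_derivation scale br1 br2 D \<longleftrightarrow>
    compatible_leibniz_algebra scale br1 br2 \<and>
    leibniz_central_derivation scale br1 D \<and> leibniz_central_derivation scale br2 D"

definition ternary_central_derivation ::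
    "('k::field \<Rightarrow> 'l::ab_group_add \<Rightarrow> 'l) \<Rightarrow> ('l \<Rightarrow> 'l \<Rightarrow> 'l \<Rightarrow> 'l) \<Rightarrow> ('l \<Rightarrow> 'l) \<Rightarrow> bool"
  where "ternary_central_derivation scale tbr D \<longleftrightarrow>
    ternary_leibniz_algebra scale tbr \<and> Vector_Spaces.linear scale scale D \<and>
    (\<forall>x y z. D (tbr x y z) = 0 \<and> tbr (D x) y z = 0 \<and> tbr x (D y) z = 0 \<and> tbr x y (D z) = 0)"

definition compatible_ternary_central_derivation ::
    "('k::field \<Rightarrow> 'l::ab_group_add \<Rightarrow> 'l) \<Rightarrow> ('l \<Rightarrow> 'l \<Rightarrow> 'l \<Rightarrow> 'l) \<Rightarrow> ('l \<Rightarrow> 'l \<Rightarrow> 'l \<Rightarrow> 'l)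
      \<Rightarrow> ('l \<Rightarrow> 'l) \<Rightarrow> bool"
  where "compatible_ternary_central_derivation scale t1 t2 D \<longleftrightarrow>
    compatible_ternary_leibniz_algebra scale t1 t2 \<and>
    ternary_central_derivation scale t1 D \<and> ternary_central_derivation scale t2 D"

end

theory Submission
  imports Defs
begin

text \<open>
  Each of the four terms in the ternary central derivation condition is a nested binary bracket
  in which \<open>D\<close> meets one binary bracket, outer or inner. That bracket vanishes, and what remains
  is either \<open>0\<close> or a bracket \<open>[x, 0]\<close>, which is \<open>0\<close> by linearity. The two brackets do not
  interact, so the condition is checked for one Leibniz algebra at a time. The ternary Leibniz
  identity holds because right multiplication by \<open>[t, u]\<close> is a derivation of the binary bracket
  and hence of \<open>[x, [y, z]]\<close>; compatibility of the two ternary brackets is a hypothesis.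
\<close>

context leibniz_algebra
begin

lemma bracket_add_right: "br x (y + z) = br x y + br x z"
  by (rule module_hom.add[OF module_hom_iff_linear[THEN iffD2, OF linear_right]])

lemma bracket_zero_right: "br x 0 = 0"
  by (rule module_hom.zero[OF module_hom_iff_linear[THEN iffD2, OF linear_right]])

lemma ternary_leibniz_algebra_assoc_ternary:
  "ternary_leibniz_algebra scale (assoc_ternary br)"
proof (intro ternary_leibniz_algebra.intro ternary_leibniz_algebra_axioms.intro,
    unfold assoc_ternary_def)
  show "vector_space scale" ..
  fix x y z t u
  show "Vector_Spaces.linear scale scale (\<lambda>x. br x (br y z))"
    by (rule linear_left)
  show "Vector_Spaces.linear scale scale (\<lambda>y. br x (br y z))"
    using Vector_Spaces.linear_compose[OF linear_left linear_right] by (simp add: comp_def)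
  show "Vector_Spaces.linear scale scale (\<lambda>z. br x (br y z))"
    using Vector_Spaces.linear_compose[OF linear_right linear_right] by (simp add: comp_def)
  define w where "w = br t u"
  \<comment> \<open>The derivation property of right multiplication by \<open>w\<close> is used first on the outer bracket,
    then on the inner one.\<close>
  have "br (br x (br y z)) w = br x (br (br y z) w) + br (br x w) (br y z)"
    by (rule leibniz)
  also have "br x (br (br y z) w) = br x (br y (br z w)) + br x (br (br y w) z)"
    by (simp only: leibniz[of y z w] bracket_add_right)
  finally show "br (br x (br y z)) (br t u) =
      br x (br y (br z (br t u))) + br x (br (br y (br t u)) z) + br (br x (br t u)) (br y z)"
    unfolding w_def .
qed

end

lemma ternary_central_derivation_assoc_ternary:
  assumes "leibniz_central_derivation scale br D"
  shows "ternary_central_derivation scale (assoc_ternary br) D"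
proof -
  interpret leibniz_algebra scale br
    using assms by (simp add: leibniz_central_derivation_def)
  show ?thesis
    using assms ternary_leibniz_algebra_assoc_ternary
    by (simp add: leibniz_central_derivation_def ternary_central_derivation_def
        assoc_ternary_def bracket_zero_right)
qed

theorem proposition2p3:
  fixes scale :: "'k::field \<Rightarrow> 'l::ab_group_add \<Rightarrow> 'l"
    and br1 br2 :: "'l \<Rightarrow> 'l \<Rightarrow> 'l"
    and D :: "'l \<Rightarrow> 'l"
  assumes "compatible_leibniz_algebra scale br1 br2"
    and "ternary_compatible (assoc_ternary br1) (assoc_ternary br2)"
    and "compatible_leibniz_central_derivation scale br1 br2 D"
  shows "compatible_ternary_central_derivation scale (assoc_ternary br1) (assoc_ternary br2) D"
proof -
  have "ternary_central_derivation scale (assoc_ternary br1) D"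
    and "ternary_central_derivation scale (assoc_ternary br2) D"
    using assms(3)
    by (simp_all add: compatible_leibniz_central_derivation_def
        ternary_central_derivation_assoc_ternary)
  then show ?thesis
    using assms(2)
    by (simp add: compatible_ternary_central_derivation_def ternary_central_derivation_def
        compatible_ternary_leibniz_algebra_def compatible_ternary_leibniz_algebra_axioms_def)
qed

end
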